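(* Let $C>0$, let $k>1$ be an integer, and let $T$ satisfy $0<T<C/k$; set $r=kT/C$. Then the online algorithm $\textsc{FlushWhenFull}$ is $\frac{k+1}{k(1-r)}$-competitive in the discrete $k$-wallet model $\mathcal{M}^{C,k}_T$: there is a constant $c$ depending only on the model parameters such that for every transaction sequence $\mathsf{Tx}$ with all values at most $T$, \[ V_{\mathrm{OPT}}(\mathsf{Tx}) \le \frac{k+1}{k(1-r)}\, V_{\textsc{FlushWhenFull}}(\mathsf{Tx}) + c. \]
   Context: Discrete $k$-wallet model $\mathcal{M}^{C,k}_T$: Time is divided into discrete slots $t=1,2,\dots$. A transaction sequence is $\mathsf{Tx}=(\mathsf{tx}_1,\dots,\mathsf{tx}_n)$, where $\mathsf{tx}_t\in[0,T]$ is the value of the transaction arriving at slot $t$ (value $0$ means no transaction). A total collateral $C$ is divided into $k$ wallets, each of capacity $C/k$. Each wallet is either online with some available (uncommitted) collateral $R\in[0,C/k]$, or offline. When a transaction of value $v$ arrives, the policy must immediately either settle it, using an online wallet with $R\ge v$ (whose available collateral becomes $R-v$), or discard it. At any time $t$ the policy may flush a wallet; the wallet is then offline during the slots of the interval $(t,t+F]$ (with $F$ a fixed positive integer flush period), after which it is online again with available collateral reset to $C/k$. For a policy $\mathrm{A}$, $V_{\mathrm{A}}(\mathsf{Tx})$ denotes the total value of transactions it settles. An algorithm is online if its decisions at time $N$ depend only on $\mathsf{tx}_1,\dots,\mathsf{tx}_N$. $\mathrm{OPT}$ denotes an optimal offline $k$-wallet policy, i.e. $V_{\mathrm{OPT}}(\mathsf{Tx})$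 is the maximum settled value achievable by any $k$-wallet policy with full knowledge of $\mathsf{Tx}$. An algorithm $\mathrm{A}$ is $\alpha$-competitive in this model if for every sequence $\mathsf{Tx}$ with values at most $T$, $V_{\mathrm{OPT}}(\mathsf{Tx})\le \alpha V_{\mathrm{A}}(\mathsf{Tx})+O(1)$, where the $O(1)$ constant may depend on $C,k,T$ (and $F$) but not on $\mathsf{Tx}$ or its length. Algorithm $\textsc{FlushWhenFull}$: the wallets are used one at a time in a fixed cyclic (round-robin) order. The current active wallet settles each arriving transaction as long as it fits. When a transaction arrives that does not fit in the active wallet, that wallet is immediately flushed and the next wallet in cyclic order becomes the active wallet (if it is online, it handles the transaction); if the next wallet is still offline (in its flush period), the algorithm waits for it to come back online, discarding all transactions arriving during this wait. *)

theory Defs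
  imports Complex_Main
begin

text \<open>
  \<open>Online R\<close>: online with uncommitted collateral \<open>R\<close>.
  \<open>Offline m\<close>: offline for exactly \<open>m\<close> more slots, the current one included.
\<close>
datatype wallet = Online real | Offline nat

text \<open>Only the wallets with index below \<open>k\<close> belong to the model.\<close>
type_synonym config = "nat \<Rightarrow> wallet"

text \<open>
  The decision made in one slot: the wallet that settles the arriving transaction
  (\<open>None\<close> = discard), and the set of wallets that are flushed in this slot.
\<close>
datatype action = Action (settle: "nat option") (flush: "nat set")

definition fits :: "real \<Rightarrow> wallet \<Rightarrow> bool" where
  "fits v w = (case w of Online R \<Rightarrow> v \<le> R | Offline m \<Rightarrow> False)"

fun charge :: "real \<Rightarrow> wallet \<Rightarrow> wallet" where
  "charge v (Online R) = Online (R - v)"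
| "charge v (Offline m) = Offline m"

fun tick :: "real \<Rightarrow> wallet \<Rightarrow> wallet" where
  "tick cap (Online R) = Online R"
| "tick cap (Offline m) = (if m \<le> 1 then Online cap else Offline (m - 1))"

definition initial_config :: "real \<Rightarrow> nat \<Rightarrow> config" where
  "initial_config C k = (\<lambda>w. Online (C / real k))"

text \<open>
  A wallet flushed in slot \<open>t\<close> is offline in the slots \<open>t + 1, \<dots>, t + F\<close>; it may still
  settle the transaction of slot \<open>t\<close> itself, so settling precedes flushing.
\<close>
definition next_config :: "real \<Rightarrow> nat \<Rightarrow> nat \<Rightarrow> config \<Rightarrow> real \<Rightarrow> action \<Rightarrow> config" where
  "next_config C k F S v a =
     (\<lambda>w. if w \<in> flush a then Offline F
          else tick (C / real k) (if settle a = Some w then charge v (S w) else S w))"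

definition legal_action :: "nat \<Rightarrow> config \<Rightarrow> real \<Rightarrow> action \<Rightarrow> bool" where
  "legal_action k S v a \<longleftrightarrow>
     flush a \<subseteq> {..<k} \<and> (\<forall>w. settle a = Some w \<longrightarrow> w < k \<and> fits v (S w))"

fun legal_run :: "real \<Rightarrow> nat \<Rightarrow> nat \<Rightarrow> config \<Rightarrow> real list \<Rightarrow> action list \<Rightarrow> bool" where
  "legal_run C k F S [] [] \<longleftrightarrow> True"
| "legal_run C k F S (v # vs) (a # as) \<longleftrightarrow>
     legal_action k S v a \<and> legal_run C k F (next_config C k F S v a) vs as"
| "legal_run C k F S _ _ \<longleftrightarrow> False"

definition legal_actions :: "real \<Rightarrow> nat \<Rightarrow> nat \<Rightarrow> real list \<Rightarrow> action list set" where
  "legal_actions C k F Tx = {as. legal_run C k F (initial_config C k) Tx as}"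

definition settled_value :: "real list \<Rightarrow> action list \<Rightarrow> real" where
  "settled_value Tx as = (\<Sum>(v, a) \<leftarrow> zip Tx as. if settle a = None then 0 else v)"

definition V_OPT :: "real \<Rightarrow> nat \<Rightarrow> nat \<Rightarrow> real list \<Rightarrow> real" where
  "V_OPT C k F Tx = Max (settled_value Tx ` legal_actions C k F Tx)"

definition tx_sequences :: "real \<Rightarrow> real list set" where
  "tx_sequences T = {Tx. set Tx \<subseteq> {0..T}}"

type_synonym policy = "real list \<Rightarrow> action list"

definition V :: "policy \<Rightarrow> real list \<Rightarrow> real" where
  "V A Tx = settled_value Tx (A Tx)"

definition wallet_policy :: "real \<Rightarrow> nat \<Rightarrow> nat \<Rightarrow> real \<Rightarrow> policy \<Rightarrow> bool" where
  "wallet_policy C k F T A \<longleftrightarrow> (\<forall>Tx \<in> tx_sequences T. A Tx \<in> legal_actions C k F Tx)"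

definition online :: "real \<Rightarrow> policy \<Rightarrow> bool" where
  "online T A \<longleftrightarrow>
     (\<forall>Tx \<in> tx_sequences T. \<forall>Tx' \<in> tx_sequences T. \<forall>N.
        N \<le> length Tx \<and> N \<le> length Tx' \<and> take N Tx = take N Tx' \<longrightarrow>
        take N (A Tx) = take N (A Tx'))"

definition competitive ::
    "real \<Rightarrow> nat \<Rightarrow> nat \<Rightarrow> real \<Rightarrow> real \<Rightarrow> policy \<Rightarrow> bool" where
  "competitive C k F T \<alpha> A \<longleftrightarrow>
     (\<exists>c. \<forall>Tx \<in> tx_sequences T. V_OPT C k F Tx \<le> \<alpha> * V A Tx + c)"

text \<open>
  The decision of FlushWhenFull with active wallet \<open>i\<close>, and the active wallet afterwards.
  The algorithm is waiting exactly when its active wallet is offline.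
\<close>
definition fwf_decide :: "nat \<Rightarrow> config \<Rightarrow> nat \<Rightarrow> real \<Rightarrow> action \<times> nat" where
  "fwf_decide k S i v =
     (case S i of
        Offline m \<Rightarrow> (Action None {}, i)
      | Online R \<Rightarrow>
          if v \<le> R then (Action (Some i) {}, i)
          else let j = (i + 1) mod k
               in (Action (if fits v (S j) then Some j else None) {i}, j))"

fun fwf_run :: "real \<Rightarrow> nat \<Rightarrow> nat \<Rightarrow> config \<Rightarrow> nat \<Rightarrow> real list \<Rightarrow> action list" where
  "fwf_run C k F S i [] = []"
| "fwf_run C k F S i (v # vs) =
     (case fwf_decide k S i v of
        (a, j) \<Rightarrow> a # fwf_run C k F (next_config C k F S v a) j vs)"

definition flush_when_full :: "real \<Rightarrow> nat \<Rightarrow> nat \<Rightarrow> policy" where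
  "flush_when_full C k F Tx = fwf_run C k F (initial_config C k) 0 Tx"


text \<open>The maximum in \<open>V_OPT\<close> is taken over a finite nonempty set, hence attained.\<close>

lemma legal_run_subset:
  "legal_run C k F S Tx as \<Longrightarrow>
     length as = length Tx \<and>
     set as \<subseteq> (\<lambda>(s, f). Action s f) ` (insert None (Some ` {..<k}) \<times> Pow {..<k})"
proof (induction C k F S Tx as rule: legal_run.induct)
  case (2 C k F S v vs a as)
  have "a \<in> (\<lambda>(s, f). Action s f) ` (insert None (Some ` {..<k}) \<times> Pow {..<k})"
    using "2.prems"
    by (cases a, cases "settle a") (auto simp: legal_action_def image_iff)
  then show ?case using 2 by auto
qed auto

lemma finite_legal_actions: "finite (legal_actions C k F Tx)"
proof (rule finite_subset)
  let ?A = "(\<lambda>(s, f). Action s f) ` (insert None (Some ` {..<k}) \<times> Pow {..<k})"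
  show "legal_actions C k F Tx \<subseteq> {as. set as \<subseteq> ?A \<and> length as = length Tx}"
    unfolding legal_actions_def by (rule Collect_mono) (use legal_run_subset in blast)
  show "finite {as. set as \<subseteq> ?A \<and> length as = length Tx}"
    by (rule finite_lists_length_eq) auto
qed

lemma legal_actions_nonempty: "legal_actions C k F Tx \<noteq> {}"
proof -
  have "legal_run C k F S Tx (replicate (length Tx) (Action None {}))" for S
    by (induction Tx arbitrary: S) (auto simp: legal_action_def)
  then show ?thesis by (auto simp: legal_actions_def)
qed

lemma V_OPT_attained: "\<exists>as \<in> legal_actions C k F Tx. V_OPT C k F Tx = settled_value Tx as"
proof -
  have "V_OPT C k F Tx \<in> settled_value Tx ` legal_actions C k F Tx"
    unfolding V_OPT_def
    by (rule Max_in) (auto simp: finite_legal_actions legal_actions_nonempty)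
  then show ?thesis by auto
qed

lemma V_OPT_upper:
  "as \<in> legal_actions C k F Tx \<Longrightarrow> settled_value Tx as \<le> V_OPT C k F Tx"
  unfolding V_OPT_def by (rule Max_ge) (auto simp: finite_legal_actions)

end

theory Submission imports Defs begin

text \<open>
  A wallet flushed in slot \<open>s\<close> cannot be used again before slot \<open>s + F + 1\<close>, so no policy settles
  more than \<open>C\<close> in \<open>F + 1\<close> consecutive slots. FlushWhenFull settles every transaction except
  while waiting, so its opponent can only gain on it in a wait. If the use of a wallet begins
  with a wait, then that wallet was flushed in some slot \<open>s\<close>, the wait ends in slot \<open>s + F\<close>, and
  from slot \<open>s\<close> until its next flush FlushWhenFull fills \<open>k\<close> wallets, each with more than
  \<open>C / k - T\<close>. In that time the opponent settles at most \<open>C\<close> in the slots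
  \<open>s, \<dots>, s + F\<close>, and afterwards at most what FlushWhenFull does, which is at most \<open>C / k\<close>.
  The ratio of \<open>C + C / k\<close> to \<open>k (C / k - T)\<close> is the competitive ratio.
\<close>

section \<open>Any policy settles at most \<open>C\<close> in \<open>F + 1\<close> slots\<close>

definition gain :: "real \<Rightarrow> action \<Rightarrow> real" where
  "gain v a = (if settle a = None then 0 else v)"

lemma settled_value_Nil [simp]: "settled_value [] as = 0" "settled_value vs [] = 0"
  by (simp_all add: settled_value_def)

lemma settled_value_Cons [simp]:
  "settled_value (v # vs) (a # as) = gain v a + settled_value vs as"
  by (simp add: settled_value_def gain_def)

fun within_capacity :: "real \<Rightarrow> wallet \<Rightarrow> bool" where
  "within_capacity cap (Online R) \<longleftrightarrow> 0 \<le> R \<and> R \<le> cap"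
| "within_capacity cap (Offline m) \<longleftrightarrow> True"

text \<open>Bounds what one wallet can still settle in the next \<open>L\<close> slots, the current
  one included, for \<open>L\<close> \<le> \<open>F + 1\<close>: a flush from now on brings no fresh
  collateral within that time.\<close>

fun budget :: "real \<Rightarrow> nat \<Rightarrow> wallet \<Rightarrow> real" where
  "budget cap L (Online R) = (if L = 0 then 0 else R)"
| "budget cap L (Offline m) = (if L \<le> m then 0 else cap)"

lemma budget_le:
  assumes "0 \<le> cap" "within_capacity cap x" shows "budget cap L x \<le> cap"
  using assms by (cases x) auto

lemma budget_tick:
  assumes "0 \<le> cap" "within_capacity cap x"
  shows "budget cap L (tick cap x) \<le> budget cap (Suc L) x"
  using assms by (cases x) auto

lemma budget_nonneg:
  assumes "0 \<le> cap" "within_capacity cap x" shows "0 \<le> budget cap L x"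
  using assms by (cases x) auto

lemma within_capacity_tick:
  "0 \<le> cap \<Longrightarrow> within_capacity cap x \<Longrightarrow> within_capacity cap (tick cap x)"
  by (cases x) auto

lemma within_capacity_charge:
  "0 \<le> v \<Longrightarrow> fits v x \<Longrightarrow> within_capacity cap x \<Longrightarrow> within_capacity cap (charge v x)"
  by (cases x) (auto simp: fits_def)

lemma budget_charge:
  "fits v x \<Longrightarrow> budget cap (Suc L) (charge v x) = budget cap (Suc L) x - v"
  by (cases x) (auto simp: fits_def)

lemma within_capacity_next_config:
  assumes "0 \<le> C" "0 \<le> v" "legal_action k S v a" "\<And>w. within_capacity (C / real k) (S w)"
  shows "within_capacity (C / real k) (next_config C k F S v a w)"
  using assms
  by (auto simp: next_config_def legal_action_def
      intro!: within_capacity_tick within_capacity_charge)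

text \<open>A flushed wallet has budget 0, being offline for \<open>F\<close> \<ge> \<open>L\<close>
  slots; any other wallet pays for what it settles out of its own budget.\<close>

lemma budget_next_config:
  assumes "0 \<le> C" "0 \<le> v" "legal_action k S v a" "L \<le> F"
    and ok: "\<And>w. within_capacity (C / real k) (S w)"
  shows "budget (C / real k) L (next_config C k F S v a w)
    \<le> budget (C / real k) (Suc L) (S w) - (if settle a = Some w then v else 0)"
proof -
  define x where "x = (if settle a = Some w then charge v (S w) else S w)"
  have x: "within_capacity (C / real k) x"
    using assms by (auto simp: x_def legal_action_def intro: within_capacity_charge)
  have "budget (C / real k) L (next_config C k F S v a w) \<le> budget (C / real k) (Suc L) x"
    using assms(1,4) budget_tick[OF _ x] budget_nonneg[OF _ x]
    by (auto simp: next_config_def x_def[symmetric])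
  also have "\<dots> = budget (C / real k) (Suc L) (S w) - (if settle a = Some w then v else 0)"
    using assms(3) by (auto simp: x_def legal_action_def budget_charge)
  finally show ?thesis .
qed

lemma settled_value_le_budget:
  assumes "legal_run C k F S vs as" "0 \<le> C" "set vs \<subseteq> {0..}" "length vs \<le> Suc F"
    "\<And>w. within_capacity (C / real k) (S w)"
  shows "settled_value vs as \<le> (\<Sum>w<k. budget (C / real k) (length vs) (S w))"
  using assms
proof (induction C k F S vs as rule: legal_run.induct)
  case (1 C k F S)
  then show ?case by (auto intro!: sum_nonneg budget_nonneg)
next
  case (2 C k F S v vs a as)
  have v: "0 \<le> v" and a: "legal_action k S v a" using 2 by auto
  let ?S = "next_config C k F S v a"
  have g: "gain v a = (\<Sum>w<k. if settle a = Some w then v else 0)"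
    using a by (cases "settle a") (auto simp: gain_def legal_action_def)
  have "settled_value vs as \<le> (\<Sum>w<k. budget (C / real k) (length vs) (?S w))"
    using 2 v a by (intro "2.IH") (auto intro!: within_capacity_next_config)
  also have "\<dots> \<le> (\<Sum>w<k. budget (C / real k) (Suc (length vs)) (S w)
      - (if settle a = Some w then v else 0))"
    using 2 v a by (intro sum_mono budget_next_config) auto
  finally show ?case by (simp add: sum_subtractf g)
qed auto

lemma legal_run_take:
  "legal_run C k F S vs as \<Longrightarrow> legal_run C k F S (take n vs) (take n as)"
  by (induction C k F S vs as arbitrary: n rule: legal_run.induct)
    (auto simp: take_Cons split: nat.split)

text \<open>After the first \<open>s\<close> slots the configuration is still within capacity, so
  for the next at most \<open>F + 1\<close> slots the budgets of the \<open>k\<close> wallets sum to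
  at most \<open>k * (C / k)\<close>.\<close>

lemma settled_value_window:
  assumes "legal_run C k F S vs as" "0 \<le> C" "0 < k" "set vs \<subseteq> {0..}"
    "\<And>w. within_capacity (C / real k) (S w)" "b \<le> s + Suc F" "s \<le> b"
  shows "settled_value (take b vs) (take b as) \<le> settled_value (take s vs) (take s as) + C"
  using assms
proof (induction C k F S vs as arbitrary: s b rule: legal_run.induct)
  case (2 C k F S v vs a as)
  show ?case
  proof (cases s)
    case (Suc s')
    then obtain b' where b: "b = Suc b'" using 2 by (cases b) auto
    have "settled_value (take b' vs) (take b' as) \<le> settled_value (take s' vs) (take s' as) + C"
      using 2 Suc b by (intro "2.IH") (auto intro!: within_capacity_next_config)
    then show ?thesis by (simp add: Suc b)
  next
    case 0
    have "legal_run C k F S (take b (v # vs)) (take b (a # as))"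
      using "2.prems"(1) by (rule legal_run_take)
    then have "settled_value (take b (v # vs)) (take b (a # as))
        \<le> (\<Sum>w<k. budget (C / real k) (length (take b (v # vs))) (S w))"
      using 2 0 set_take_subset[of b "v # vs"]
      by (intro settled_value_le_budget) auto
    also have "\<dots> \<le> (\<Sum>w<k. C / real k)"
      using 2 by (intro sum_mono budget_le) auto
    also have "\<dots> = C" using 2 by simp
    finally show ?thesis by (simp add: 0)
  qed
qed auto

lemma settled_value_take_Suc:
  assumes "length as = length vs" "t < length vs"
  shows "settled_value (take (Suc t) vs) (take (Suc t) as)
    = settled_value (take t vs) (take t as) + gain (vs ! t) (as ! t)"
  using assms by (induction vs as arbitrary: t rule: list_induct2')
    (auto simp: take_Cons nth_Cons split: nat.splits)

section \<open>FlushWhenFull against an opponent with bounded gain per window\<close>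

fun committed :: "real \<Rightarrow> wallet \<Rightarrow> real" where
  "committed cap (Online R) = cap - R"
| "committed cap (Offline m) = 0"

text \<open>
  If wallet \<open>i\<close> is active and wallet \<open>w\<close> is offline, this many wallets have been filled since
  the flush of \<open>w\<close>; for \<open>w = i\<close> it is \<open>k - 1\<close>.
\<close>
definition filled_since :: "nat \<Rightarrow> nat \<Rightarrow> nat \<Rightarrow> nat" where
  "filled_since k i w = (if w < i then i - Suc w else i + k - Suc w)"

lemma filled_since_self: "0 < k \<Longrightarrow> filled_since k i i = k - 1"
  by (simp add: filled_since_def)

lemma filled_since_next:
  assumes "i < k" "w < k"
  shows "filled_since k (Suc i mod k) w = (if w = i then 0 else Suc (filled_since k i w))"
proof (cases "Suc i = k")
  case True
  then show ?thesis using assms by (auto simp: filled_since_def)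
next
  case False
  then show ?thesis using assms by (auto simp: filled_since_def)
qed

text \<open>The opponent is reduced to its cumulative value \<open>G\<close>. \<open>ratio\<close>
  fixes \<alpha> without division: \<alpha> times the value guaranteed by \<open>k\<close> filled
  wallets pays for \<open>C + C / k\<close>.\<close>

locale fwf_against_opponent =
  fixes C T \<alpha> :: real and k F :: nat and G :: "nat \<Rightarrow> real"
  assumes C_pos: "C > 0" and k_gt_1: "k > 1" and F_pos: "F > 0"
    and T_pos: "0 < T" and T_less: "T < C / real k"
    and ratio: "\<alpha> * (real k * (C / real k - T)) = C + C / real k"
    and window: "s \<le> b \<Longrightarrow> b \<le> s + Suc F \<Longrightarrow> G b \<le> G s + C"
begin

abbreviation cap :: real where "cap \<equiv> C / real k"

lemma cap_pos: "0 < cap"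
  using T_pos T_less by linarith

lemma ratio_ge_1: "1 \<le> \<alpha>"
proof (rule ccontr)
  assume "\<not> 1 \<le> \<alpha>"
  have p: "0 < real k * (cap - T)" using T_less k_gt_1 by simp
  have "\<alpha> * (real k * (cap - T)) < 1 * (real k * (cap - T))"
    using \<open>\<not> 1 \<le> \<alpha>\<close> p by (intro mult_strict_right_mono) auto
  also have "\<dots> = C - real k * T" using k_gt_1 by (simp add: algebra_simps)
  also have "\<dots> < C" using T_pos k_gt_1 by simp
  finally show False using ratio cap_pos by simp
qed

text \<open>
  \<open>G N\<close> is what the opponent and \<open>A\<close> what FlushWhenFull has settled before slot \<open>N\<close>.
  If \<open>w\<close> was flushed in slot \<open>s\<close>, then \<open>A - filled_since k i w * (cap - T) - committed cap (S i)\<close>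
  bounds from above what FlushWhenFull had settled before \<open>s\<close>.
\<close>
definition offline_inv :: "nat \<Rightarrow> real \<Rightarrow> config \<Rightarrow> nat \<Rightarrow> nat \<Rightarrow> nat \<Rightarrow> bool" where
  "offline_inv N A S i w m \<longleftrightarrow> 1 \<le> m \<and>
     (\<exists>s \<le> N. N + m = s + Suc F \<and>
        G s \<le> \<alpha> * (A - real (filled_since k i w) * (cap - T) - committed cap (S i)))"

text \<open>The second alternative describes an active wallet whose use began with a wait.\<close>
definition active_inv :: "nat \<Rightarrow> real \<Rightarrow> real \<Rightarrow> bool" where
  "active_inv N A R \<longleftrightarrow> 0 \<le> R \<and> R \<le> cap \<and>
     (G N \<le> \<alpha> * A \<or>
      G N \<le> \<alpha> * (A - real (k - 1) * (cap - T) - (cap - R)) + C + (cap - R))"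

text \<open>Online wallets other than \<open>i\<close> are untouched, since a wallet is flushed as
  soon as it ceases to be active.\<close>

definition fwf_inv :: "nat \<Rightarrow> real \<Rightarrow> config \<Rightarrow> nat \<Rightarrow> bool" where
  "fwf_inv N A S i \<longleftrightarrow> i < k \<and>
     (\<forall>w<k. case S w of
        Online R \<Rightarrow> if w = i then active_inv N A R else R = cap
      | Offline m \<Rightarrow> offline_inv N A S i w m)"

lemma offline_inv_tick:
  assumes "offline_inv N A S i w m" "\<not> m \<le> 1"
    and "A - real (filled_since k i w) * (cap - T) - committed cap (S i)
      \<le> A' - real (filled_since k i' w) * (cap - T) - committed cap (S' i')"
  shows "offline_inv (Suc N) A' S' i' w (m - 1)"
proof -
  from assms(1) obtain s where s: "s \<le> N" "N + m = s + Suc F"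
    "G s \<le> \<alpha> * (A - real (filled_since k i w) * (cap - T) - committed cap (S i))"
    by (auto simp: offline_inv_def)
  have "\<alpha> * (A - real (filled_since k i w) * (cap - T) - committed cap (S i))
      \<le> \<alpha> * (A' - real (filled_since k i' w) * (cap - T) - committed cap (S' i'))"
    using assms(3) ratio_ge_1 by (intro mult_left_mono) auto
  with s assms(2) show ?thesis
    unfolding offline_inv_def by (intro conjI exI[of _ s]) auto
qed

lemma active_inv_after_wait:
  assumes "offline_inv N A S i w m" "m \<le> 1"
    and "A - real (filled_since k i w) * (cap - T) - committed cap (S i)
      \<le> A' - real (k - 1) * (cap - T)"
  shows "active_inv (Suc N) A' cap"
proof -
  from assms(1,2) obtain s where s: "s \<le> N" "Suc N = s + Suc F"
    "G s \<le> \<alpha> * (A - real (filled_since k i w) * (cap - T) - committed cap (S i))"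
    by (auto simp: offline_inv_def)
  have "\<alpha> * (A - real (filled_since k i w) * (cap - T) - committed cap (S i))
      \<le> \<alpha> * (A' - real (k - 1) * (cap - T))"
    using assms(3) ratio_ge_1 by (intro mult_left_mono) auto
  \<comment> \<open>Since \<open>m\<close> = 1, exactly the \<open>F + 1\<close> slots
    \<open>s\<close>, ..., \<open>N\<close> have passed, the longest stretch that
    \<open>window\<close> covers.\<close>
  moreover have "G (Suc N) \<le> G s + C" using s by (intro window) auto
  ultimately show ?thesis using s cap_pos by (simp add: active_inv_def)
qed

text \<open>In the first alternative, \<open>v\<close> \<le> \<open>\<alpha> * v\<close> absorbs the
  opponent's gain. In the second, \<open>A\<close> and \<open>cap - R\<close> both grow by
  \<open>v\<close>, so the \<alpha>-term stays fixed and the last summand absorbs the gain.\<close>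

lemma active_inv_settle:
  assumes "active_inv N A R" "0 \<le> v" "v \<le> R" "G (Suc N) \<le> G N + v"
  shows "active_inv (Suc N) (A + v) (R - v)"
proof -
  have "v \<le> \<alpha> * v" using mult_right_mono[OF ratio_ge_1 \<open>0 \<le> v\<close>] by simp
  then show ?thesis using assms by (auto simp: active_inv_def algebra_simps)
qed

text \<open>With \<open>R < T\<close> the active wallet too holds more than \<open>cap - T\<close>,
  which completes a round of \<open>k\<close> filled wallets; by \<open>ratio\<close> the round pays
  for \<open>C + cap\<close>, hence for the excess \<open>C + (cap - R)\<close>.\<close>

lemma active_inv_full:
  assumes "active_inv N A R" "R < T" shows "G N \<le> \<alpha> * A"
proof (cases "G N \<le> \<alpha> * A")
  case False
  then have G: "G N \<le> \<alpha> * (A - real (k - 1) * (cap - T) - (cap - R)) + C + (cap - R)"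
    and R: "0 \<le> R"
    using assms by (auto simp: active_inv_def)
  note G
  also have "\<alpha> * (A - real (k - 1) * (cap - T) - (cap - R))
      \<le> \<alpha> * (A - real (k - 1) * (cap - T) - (cap - T))"
    using ratio_ge_1 assms(2) by (intro mult_left_mono) auto
  also have "A - real (k - 1) * x - x = A - real k * x" for x
    using k_gt_1 by (simp add: of_nat_diff algebra_simps)
  also have "\<alpha> * (A - real k * (cap - T)) = \<alpha> * A - \<alpha> * (real k * (cap - T))"
    by (rule right_diff_distrib)
  finally show ?thesis using ratio R by simp
qed simp

text \<open>While FlushWhenFull waits, the invariant mentions \<open>G\<close> only at flush slots;
  the opponent's gain is charged all at once, by \<open>window\<close>, when the wait ends.\<close>

lemma fwf_inv_step:
  assumes inv: "fwf_inv N A S i" and v: "0 \<le> v" "v \<le> T" and G: "G (Suc N) \<le> G N + v"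
    and step: "fwf_decide k S i v = (a, j)"
  shows "fwf_inv (Suc N) (A + gain v a) (next_config C k F S v a) j"
proof -
  have i: "i < k" using inv by (simp add: fwf_inv_def)
  have online: "R = cap" if "w < k" "S w = Online R" "w \<noteq> i" for w R
    using inv that by (auto simp: fwf_inv_def dest!: spec[of _ w])
  have offline: "offline_inv N A S i w m" if "w < k" "S w = Offline m" for w m
    using inv that by (auto simp: fwf_inv_def dest!: spec[of _ w])
  have active: "active_inv N A R" if "S i = Online R" for R
    using inv i that by (auto simp: fwf_inv_def dest!: spec[of _ i])
  let ?S = "next_config C k F S v a"
  show ?thesis
  proof (cases "S i")
    case (Offline m)
    then have a: "a = Action None {}" "j = i" using step by (auto simp: fwf_decide_def)
    have S: "?S w = tick cap (S w)" for w by (simp add: a next_config_def)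
    \<comment> \<open>Coming back online with \<open>cap\<close> commits nothing, so the end of the
      wait leaves the bounds of the other offline wallets unchanged.\<close>
    have c: "committed cap (?S i) = 0" "committed cap (S i) = 0" using Offline by (auto simp: S)
    have "case ?S w of Online R \<Rightarrow> if w = i then active_inv (Suc N) A R else R = cap
        | Offline m \<Rightarrow> offline_inv (Suc N) A ?S i w m" if w: "w < k" for w
    proof (cases "S w")
      case (Online R)
      then show ?thesis using online[OF w] Offline by (auto simp: S)
    next
      case (Offline m')
      note o = offline[OF w Offline]
      show ?thesis
      proof (cases "m' \<le> 1")
        case True
        then show ?thesis
          using Offline active_inv_after_wait[OF o True, of A] i k_gt_1
          by (auto simp: S filled_since_self c)
      next
        case False
        then show ?thesis
          using Offline offline_inv_tick[OF o False, of A i ?S] by (auto simp: S[of w] c)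
      qed
    qed
    moreover have "A + gain v a = A" by (simp add: a gain_def)
    ultimately show ?thesis unfolding fwf_inv_def a(2) using i by presburger
  next
    case (Online R)
    note act = active[OF Online]
    show ?thesis
    proof (cases "v \<le> R")
      case True
      then have a: "a = Action (Some i) {}" "j = i"
        using step Online by (auto simp: fwf_decide_def)
      have Si: "?S i = Online (R - v)" by (simp add: a next_config_def Online)
      have S: "?S w = tick cap (S w)" if "w \<noteq> i" for w using that by (simp add: a next_config_def)
      have "case ?S w of Online R \<Rightarrow> if w = i then active_inv (Suc N) (A + v) R else R = cap
          | Offline m \<Rightarrow> offline_inv (Suc N) (A + v) ?S i w m" if w: "w < k" for w
      proof (cases "w = i")
        case True
        then show ?thesis using active_inv_settle[OF act v(1) \<open>v \<le> R\<close> G] Si by simp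
      next
        case wi: False
        show ?thesis
        proof (cases "S w")
          case (Online R')
          then show ?thesis using online[OF w] wi by (auto simp: S)
        next
          case (Offline m)
          note o = offline[OF w Offline]
          \<comment> \<open>\<open>A\<close> and the committed collateral of \<open>i\<close> both
            grow by \<open>v\<close>, which cancels.\<close>
          show ?thesis
            using Offline wi offline_inv_tick[OF o, of "A + v" i ?S]
            by (auto simp: S[OF wi] Si Online)
        qed
      qed
      moreover have "A + gain v a = A + v" by (simp add: a gain_def)
      ultimately show ?thesis unfolding fwf_inv_def a(2) using i by presburger
    next
      case full: False
      define g where "g = gain v a"
      have j: "j = Suc i mod k"
        and a: "a = Action (if fits v (S j) then Some j else None) {i}"
        using step Online full by (auto simp: fwf_decide_def Let_def)
      have jk: "j < k" and ji: "j \<noteq> i"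
        using i k_gt_1 by (auto simp: j mod_Suc)
      have GN: "G N \<le> \<alpha> * A" using active_inv_full[OF act] full v by simp
      have Si: "?S i = Offline F" by (simp add: a next_config_def)
      have S: "?S w = tick cap (S w)" if "w \<noteq> i" "w \<noteq> j" for w
        using that by (simp add: a next_config_def)
      have fits_online: "fits v (S j) \<longleftrightarrow> S j = Online cap"
        using online[OF jk _ ji] v T_less by (cases "S j") (auto simp: fits_def)
      have Sj: "?S j = (if S j = Online cap then Online (cap - v) else tick cap (S j))"
        using ji fits_online by (auto simp: a next_config_def)
      have g: "g = (if S j = Online cap then v else 0)"
        by (simp add: g_def gain_def a fits_online)
      have c: "committed cap (?S j) = g"
        using online[OF jk _ ji] by (cases "S j") (auto simp: Sj g)
      have fs: "filled_since k j w = Suc (filled_since k i w)" if "w < k" "w \<noteq> i" for w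
        using filled_since_next[OF i that(1)] that by (simp add: j)
      \<comment> \<open>The increment of \<open>filled_since\<close> counts wallet \<open>i\<close>,
        whose committed \<open>cap - R\<close> exceeds \<open>cap - T\<close> because
        \<open>R\<close> < \<open>v\<close> \<le> \<open>T\<close>.\<close>
      have less: "A - real (filled_since k i w) * (cap - T) - committed cap (S i)
          \<le> A + g - real (filled_since k j w) * (cap - T) - g" if "w < k" "w \<noteq> i" for w
        using full v by (simp add: fs[OF that] Online algebra_simps)
      have "case ?S w of Online R \<Rightarrow> if w = j then active_inv (Suc N) (A + g) R else R = cap
          | Offline m \<Rightarrow> offline_inv (Suc N) (A + g) ?S j w m" if w: "w < k" for w
      proof (cases "w = i")
        case True
        have "filled_since k j i = 0" using filled_since_next[OF i i] by (simp add: j)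
        \<comment> \<open>The flush slot is \<open>N\<close> itself; no wallet has been filled since
          and \<open>g\<close> cancels, so \<open>GN\<close> is the required bound.\<close>
        then show ?thesis using GN F_pos c
          by (auto simp: True Si offline_inv_def intro!: exI[of _ N])
      next
        case wi: False
        show ?thesis
        proof (cases "S w")
          case (Online R')
          then have R': "R' = cap" using online[OF w _ wi] by blast
          show ?thesis
          proof (cases "w = j")
            case True
            have "g = v" using Online R' True by (simp add: g)
            moreover have "active_inv N A cap" using GN cap_pos by (simp add: active_inv_def)
            ultimately show ?thesis
              using active_inv_settle[of N A cap v] v T_less G Online R' True Sj by simp
          next
            case False
            then show ?thesis using Online R' by (simp add: S[OF wi])
          qed
        next
          case (Offline m)
          note o = offline[OF w Offline]
          have t: "?S w = tick cap (Offline m)" using Offline S[OF wi] Sj by (cases "w = j") auto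
          show ?thesis
          proof (cases "m \<le> 1")
            case True
            \<comment> \<open>Here \<open>j\<close> returns in the next slot, so the wait is the
              single slot \<open>N\<close>.\<close>
            have "active_inv (Suc N) (A + g) cap" if wj: "w = j"
            proof (rule active_inv_after_wait[OF o True])
              have "filled_since k j w = k - 1" using wj k_gt_1 by (simp add: filled_since_self)
              moreover have "g = 0" using c Offline wj True t by simp
              ultimately show "A - real (filled_since k i w) * (cap - T) - committed cap (S i)
                  \<le> A + g - real (k - 1) * (cap - T)"
                using less[OF w wi] by simp
            qed
            then show ?thesis using True by (simp add: t)
          next
            case False
            then show ?thesis
              using offline_inv_tick[OF o False, of "A + g" j ?S] less[OF w wi] c by (simp add: t)
          qed
        qed
      qed
      then show ?thesis unfolding fwf_inv_def g_def using jk by blast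
    qed
  qed
qed

text \<open>Only the current round can be unpaid: the excess is at most \<open>C\<close> from one
  window, possibly cut short inside a wait, plus \<open>cap\<close> from one wallet.\<close>

lemma fwf_inv_bound:
  assumes "fwf_inv N A S i" shows "G N \<le> \<alpha> * A + (C + cap)"
proof -
  have nn: "\<alpha> * (A - x) \<le> \<alpha> * A" if "0 \<le> x" for x
    using ratio_ge_1 that by (intro mult_left_mono) auto
  have p: "0 \<le> real n * (cap - T)" for n using T_less by simp
  show ?thesis
  proof (cases "S i")
    case (Online R)
    then have "active_inv N A R" using assms by (auto simp: fwf_inv_def dest!: spec[of _ i])
    then show ?thesis
      using nn[of "real (k - 1) * (cap - T) + (cap - R)"] p[of "k - 1"] C_pos cap_pos
      by (auto simp: active_inv_def diff_diff_eq)
  next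
    case (Offline m)
    then have "offline_inv N A S i i m" using assms by (auto simp: fwf_inv_def dest!: spec[of _ i])
    then obtain s where s: "s \<le> N" "N + m = s + Suc F"
      "G s \<le> \<alpha> * (A - real (filled_since k i i) * (cap - T))"
      by (auto simp: offline_inv_def Offline)
    moreover have "G N \<le> G s + C" using s by (intro window) auto
    ultimately show ?thesis
      using nn[OF p, of "filled_since k i i"] cap_pos by linarith
  qed
qed

lemma fwf_run_bound:
  assumes "fwf_inv N A S i" "set vs \<subseteq> {0..T}"
    "\<And>t. t < length vs \<Longrightarrow> G (Suc (N + t)) \<le> G (N + t) + vs ! t"
  shows "G (N + length vs) \<le> \<alpha> * (A + settled_value vs (fwf_run C k F S i vs)) + (C + cap)"
  using assms
proof (induction vs arbitrary: N A S i)
  case Nil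
  then show ?case using fwf_inv_bound by simp
next
  case (Cons v vs)
  obtain a j where aj: "fwf_decide k S i v = (a, j)" by force
  have "fwf_inv (Suc N) (A + gain v a) (next_config C k F S v a) j"
    using Cons.prems(1,2) Cons.prems(3)[of 0] aj by (intro fwf_inv_step[where i = i]) auto
  then have "G (Suc N + length vs) \<le> \<alpha> * (A + gain v a
      + settled_value vs (fwf_run C k F (next_config C k F S v a) j vs)) + (C + cap)"
    using Cons.prems(2) Cons.prems(3)[of "Suc _"] by (intro Cons.IH) auto
  then show ?case by (simp add: aj add.assoc)
qed

lemma flush_when_full_bound:
  assumes "G 0 = 0" "set vs \<subseteq> {0..T}"
    "\<And>t. t < length vs \<Longrightarrow> G (Suc t) \<le> G t + vs ! t"
  shows "G (length vs) \<le> \<alpha> * V (flush_when_full C k F) vs + (C + cap)"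
proof -
  have "fwf_inv 0 0 (initial_config C k) 0"
    using k_gt_1 cap_pos assms(1) by (simp add: fwf_inv_def initial_config_def active_inv_def)
  from fwf_run_bound[OF this assms(2)] assms(3) show ?thesis
    by (simp add: V_def flush_when_full_def)
qed

end

section \<open>Legality and competitiveness\<close>

lemma fwf_decide_legal:
  assumes "i < k" "fwf_decide k S i v = (a, j)"
  shows "legal_action k S v a \<and> j < k"
  using assms
  by (auto simp: fwf_decide_def legal_action_def fits_def Let_def split: wallet.splits if_splits)

lemma fwf_run_legal: "i < k \<Longrightarrow> legal_run C k F S vs (fwf_run C k F S i vs)"
  by (induction vs arbitrary: S i) (auto split: prod.split dest: fwf_decide_legal)

lemma take_fwf_run: "take n (fwf_run C k F S i vs) = fwf_run C k F S i (take n vs)"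
  by (induction vs arbitrary: n S i) (auto simp: take_Cons split: nat.split prod.split)

lemma flush_when_full_competitive:
  fixes C T :: real
  assumes "C > 0" "k > 1" "F > 0" "0 < T" "T < C / real k"
    and "\<alpha> * (real k * (C / real k - T)) = C + C / real k"
  shows "competitive C k F T \<alpha> (flush_when_full C k F)"
  unfolding competitive_def
proof (intro exI ballI)
  fix Tx assume Tx: "Tx \<in> tx_sequences T"
  obtain as where as: "as \<in> legal_actions C k F Tx" "V_OPT C k F Tx = settled_value Tx as"
    using V_OPT_attained by blast
  then have run: "legal_run C k F (initial_config C k) Tx as" by (simp add: legal_actions_def)
  then have len: "length as = length Tx" using legal_run_subset by blast
  have nonneg: "set Tx \<subseteq> {0..}" using Tx by (auto simp: tx_sequences_def)
  define G where "G t = settled_value (take t Tx) (take t as)" for t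
  interpret fwf_against_opponent C T \<alpha> k F G
  proof
    fix s b assume "s \<le> b" "b \<le> s + Suc F"
    then show "G b \<le> G s + C"
      using settled_value_window[OF run, of b s] assms nonneg
      by (simp add: G_def initial_config_def)
  qed (use assms in auto)
  have "G (length Tx) \<le> \<alpha> * V (flush_when_full C k F) Tx + (C + C / real k)"
  proof (rule flush_when_full_bound)
    fix t assume t: "t < length Tx"
    then have "0 \<le> Tx ! t" using nonneg nth_mem by fastforce
    then show "G (Suc t) \<le> G t + Tx ! t"
      using settled_value_take_Suc[OF len t] by (simp add: G_def gain_def)
  qed (use Tx in \<open>auto simp: G_def tx_sequences_def\<close>)
  then show "V_OPT C k F Tx \<le> \<alpha> * V (flush_when_full C k F) Tx + (C + C / real k)"
    using as len by (simp add: G_def)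
qed

theorem theorem2:
  fixes C T r :: real and k F :: nat
  assumes "C > 0" and "k > 1" and "F > 0"
    and "0 < T" and "T < C / real k"
    and "r = real k * T / C"
  shows "wallet_policy C k F T (flush_when_full C k F) \<and>
         online T (flush_when_full C k F) \<and>
         competitive C k F T ((real k + 1) / (real k * (1 - r))) (flush_when_full C k F)"
proof (intro conjI)
  show "wallet_policy C k F T (flush_when_full C k F)"
    using assms
    by (auto simp: wallet_policy_def legal_actions_def flush_when_full_def intro: fwf_run_legal)
  show "online T (flush_when_full C k F)"
    by (simp add: online_def flush_when_full_def take_fwf_run)
  have r: "r \<noteq> 1" "C / real k - T = C / real k * (1 - r)"
    using assms by (auto simp: field_simps)
  \<comment> \<open>The factor \<open>1 - r\<close> cancels, leaving
    \<open>(k + 1) * (C / k)\<close>.\<close>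
  have "(real k + 1) / (real k * (1 - r)) * (real k * (C / real k - T)) = C + C / real k"
    using assms(2) r(1) by (simp add: r(2) field_simps)
  then show "competitive C k F T ((real k + 1) / (real k * (1 - r))) (flush_when_full C k F)"
    using assms by (intro flush_when_full_competitive) auto
qed

end
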